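(* Let $f:\mathbb{R}^n\to\mathbb{R}$ be locally Lipschitz continuous, let $\tilde f$ be a smoothing function of $f$, and let $\nabla_x\tilde f(x,\xi,\mu)$ denote stochastic gradient estimates of $\nabla_x \tilde f(x,\mu)$. Suppose that: (1) $\mathbb{E}_\xi[\nabla_x\tilde f(x,\xi,\mu)]=\nabla_x\tilde f(x,\mu)$ for all $x\in\mathbb{R}^n$, $\mu>0$; (2) there is $G>0$ with $\mathbb{E}_\xi[\|\nabla_x\tilde f(x,\xi,\mu)\|^2]\le G^2/\mu^2$ for all $x\in\mathbb{R}^n$, $\mu>0$; (3) there is $C>0$ with $|f(x)-\tilde f(x,\mu)|\le C\mu$ for all $x\in\mathbb{R}^n$, $\mu>0$; (4) there is $C_0>0$ such that for all $\mu>0$ the gradient $\nabla_x\tilde f(\cdot,\mu)$ is Lipschitz continuous on $\mathbb{R}^n$ with constant $C_0/\mu$; (5) there is $C_1>0$ such that $|\tilde f(x,\mu')-\tilde f(x,\mu)|\le C_1|\mu'-\mu|$ for all $x\in\mathbb{R}^n$ and all $\mu,\mu'>0$; (6) there are constants $E_1,E_2>0$ such that for all $x\in\mathbb{R}^n$ and all $\mu>0$ there exist $y\in\mathcal{B}(x,E_1\mu)$ and a subgradient $g(y)\in\partial f(y)$ with $\|\nabla_x\tilde f(x,\mu)-g(y)\|\le E_2\mu$. Let $d\in(1,7/5]$ and let the smoothing stochastic gradient (SSG) method run with diminishing stepsizes $\{\alpha_k\}$ satisfying $\sum_{k=1}^\infty\alpha_k=\infty$ and $\sum_{k=1}^\infty\alpha_k^d<\infty$,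 and smoothing parameters $\mu_k=\alpha_k^{-\frac d3+\frac23}$. For each $k$ let $y_k\in\mathcal{B}(x_k,E_1\mu_k)$ and let $g(y_k)\in\partial f(y_k)$ be a subgradient satisfying $\|\nabla_x\tilde f(x_k,\mu_k)-g(y_k)\|\le E_2\mu_k$. Then $$\lim_{T\to\infty}\mathbb{E}\left[\sum_{k=1}^T\alpha_k\|g(y_k)\|^2\right]<\infty.$$ Moreover, with $A_T=\sum_{k=1}^T\alpha_k$, $$\lim_{T\to\infty}\mathbb{E}\left[\frac1{A_T}\sum_{k=1}^T\alpha_k\|g(y_k)\|^2\right]=0.$$
   Context: The problem considered is $\min_{x\in\mathbb{R}^n} f(x)$, with $f$ possibly non-smooth and non-convex. Smoothing function: for a locally Lipschitz continuous $f:\mathbb{R}^n\to\mathbb{R}$, a function $\tilde f:\mathbb{R}^n\times[0,+\infty)\to\mathbb{R}$ is a smoothing function of $f$ if for every $\mu>0$, $\tilde f(\cdot,\mu)$ is continuously differentiable on $\mathbb{R}^n$, and for every $x\in\mathbb{R}^n$, $\lim_{z\to x,\,\mu\downarrow 0}\tilde f(z,\mu)=f(x)$. Here $\nabla_x\tilde f(x,\mu)$ is the gradient of $\tilde f(\cdot,\mu)$ at $x$. $\partial f$ denotes the Clarke subdifferential of $f$, and $\mathcal{B}(x,r)$ the ball of radius $r$ centered at $x$. $\xi$ is a random vector. For each $x$, each $\mu>0$ and each realization of $\xi$, $\nabla_x\tilde f(x,\xi,\mu)\in\mathbb{R}^n$ is a stochastic gradient estimate; $\mathbb{E}_\xi$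 is the expectation with respect to the distribution of $\xi$. SSG method: given an initial point $x_1$, positive stepsizes $\{\alpha_k\}$ and positive smoothing parameters $\{\mu_k\}$ with $\mu_{k+1}\le\mu_k$, for $k=1,2,\dots$ generate a realization $\xi_k$ of $\xi$ and set $x_{k+1}=x_k-\alpha_k\nabla_x\tilde f(x_k,\xi_k,\mu_k)$. $\mathbb{E}$ denotes the total expectation over the randomness of the method.
   Formalization: The formal theorem additionally assumes that f is bounded below; without this the first claim fails, e.g. for f(x) = -(1+x^2)^(1/4) with smoothing function -(1+x^2+mu^4)^(1/4), exact gradients, d = 7/5 and alpha_k = 1/k. *)

theory Defs
  imports "HOL-Probability.Probability"
begin

text \<open>The library notion \<open>local_lipschitz\<close> is for parametrised families; this is the one-function case.\<close>

definition locally_lipschitz :: "('a::metric_space \<Rightarrow> 'b::metric_space) \<Rightarrow> bool" where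
  "locally_lipschitz f \<longleftrightarrow> (\<forall>x. \<exists>r>0. \<exists>L. L-lipschitz_on (ball x r) f)"

text \<open>Meaningful only at points of differentiability.\<close>

definition gradient :: "('a::real_inner \<Rightarrow> real) \<Rightarrow> 'a \<Rightarrow> 'a" where
  "gradient f x = (THE D. GDERIV f x :> D)"

text \<open>
  The second argument of a smoothing function is the smoothing parameter; only its positive
  values matter.  In the joint limit the point \<open>z\<close> may equal \<open>x\<close>, but the parameter stays positive.
\<close>

definition smoothing_function :: "('a::real_inner \<Rightarrow> real) \<Rightarrow> ('a \<Rightarrow> real \<Rightarrow> real) \<Rightarrow> bool" where
  "smoothing_function f ft \<longleftrightarrow>
     (\<forall>\<mu>>0. (\<forall>x. (\<lambda>z. ft z \<mu>) differentiable (at x)) \<and>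
            continuous_on UNIV (gradient (\<lambda>z. ft z \<mu>))) \<and>
     (\<forall>x. ((\<lambda>(z, \<mu>). ft z \<mu>) \<longlongrightarrow> f x) (nhds x \<times>\<^sub>F at_right 0))"

text \<open>
  The generalized directional derivative is the upper limit of the difference quotients
  for \<open>y\<close> tending to \<open>x\<close> (\<open>y = x\<close> allowed) and \<open>t\<close> decreasing to \<open>0\<close>; it is taken in the
  extended reals and is finite for locally Lipschitz functions.
\<close>

definition clarke_derivative :: "('a::real_normed_vector \<Rightarrow> real) \<Rightarrow> 'a \<Rightarrow> 'a \<Rightarrow> ereal" where
  "clarke_derivative f x v =
     Limsup (nhds x \<times>\<^sub>F at_right 0) (\<lambda>(y, t). ereal ((f (y + t *\<^sub>R v) - f y) / t))"

definition clarke_subdifferential :: "('a::real_inner \<Rightarrow> real) \<Rightarrow> 'a \<Rightarrow> 'a set" where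
  "clarke_subdifferential f x = {g. \<forall>v. ereal (g \<bullet> v) \<le> clarke_derivative f x v}"

text \<open>
  The run of the smoothing stochastic gradient method on the sample space \<open>M\<close>, started at the
  deterministic point \<open>x1\<close> and indexed from 1.  \<open>Gr z s \<mu>\<close> is the stochastic gradient estimate at
  the point \<open>z\<close> for the realization \<open>s\<close>.  The realizations \<open>\<xi> k\<close> are independent draws from the
  distribution \<open>D\<close>.
\<close>

definition ssg_method ::
  "'w measure \<Rightarrow> 's::topological_space measure \<Rightarrow> ('a::real_normed_vector \<Rightarrow> 's \<Rightarrow> real \<Rightarrow> 'a) \<Rightarrow>
   (nat \<Rightarrow> real) \<Rightarrow> (nat \<Rightarrow> real) \<Rightarrow> 'a \<Rightarrow> (nat \<Rightarrow> 'w \<Rightarrow> 's) \<Rightarrow> (nat \<Rightarrow> 'w \<Rightarrow> 'a) \<Rightarrow> bool" where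
  "ssg_method M D Gr \<alpha> \<mu> x1 \<xi> x \<longleftrightarrow>
     (\<forall>k\<ge>1. 0 < \<alpha> k) \<and>
     (\<forall>k\<ge>1. 0 < \<mu> k) \<and>
     (\<forall>k\<ge>1. \<mu> (Suc k) \<le> \<mu> k) \<and>
     prob_space.indep_vars M (\<lambda>_. borel) \<xi> {1..} \<and>
     (\<forall>k\<ge>1. distr M borel (\<xi> k) = D) \<and>
     (\<forall>\<omega>\<in>space M. x 1 \<omega> = x1) \<and>
     (\<forall>k\<ge>1. \<forall>\<omega>\<in>space M. x (Suc k) \<omega> = x k \<omega> - \<alpha> k *\<^sub>R Gr (x k \<omega>) (\<xi> k \<omega>) (\<mu> k))"

end

theory Submission
  imports Defs
begin

text \<open>
  Since \<open>x\<^sub>k\<close> depends only on the realizations before step \<open>k\<close>, it is independent of \<open>\<xi>\<^sub>k\<close>, so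
  Fubini and the descent inequality for the \<open>C\<^sub>0/\<mu>\<^sub>k\<close>-smooth function \<open>ft(\<cdot>, \<mu>\<^sub>k)\<close> show that
  one step decreases its expected value by \<open>\<alpha>\<^sub>k\<close> times the expected squared gradient norm, up to an
  error \<open>C\<^sub>0 G\<^sup>2 \<alpha>\<^sub>k\<^sup>2/\<mu>\<^sub>k\<^sup>3\<close>.  The choice of \<open>\<mu>\<^sub>k\<close> turns this error into a multiple of \<open>\<alpha>\<^sub>k\<^sup>d\<close>.
  Changing \<open>\<mu>\<^sub>k\<close> to \<open>\<mu>\<^sub>k\<^sub>+\<^sub>1\<close> costs at most \<open>C\<^sub>1(\<mu>\<^sub>k - \<mu>\<^sub>k\<^sub>+\<^sub>1)\<close>, which is absorbed by adding
  \<open>C\<^sub>1\<mu>\<^sub>k\<close> to the expected value; the latter stays bounded below, so the weighted squared gradients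
  are summable.  Passing to the subgradients adds a multiple of \<open>\<alpha>\<^sub>k\<mu>\<^sub>k\<^sup>2\<close>, a power of \<open>\<alpha>\<^sub>k\<close> with
  exponent \<open>(7 - 2d)/3\<close>, and this is at least \<open>d\<close> exactly when \<open>d \<le> 7/5\<close>.
\<close>

section \<open>Gradients and first-order estimates for differentiable functions\<close>

text \<open>Riesz representation in coordinates. \<open>gradient\<close> is a definite description,
  so uniqueness of the representing vector is needed as well as its existence.\<close>

lemma GDERIV_gradient:
  fixes \<phi> :: "'a::euclidean_space \<Rightarrow> real"
  assumes "\<phi> differentiable (at x)"
  shows "GDERIV \<phi> x :> gradient \<phi> x"
proof -
  obtain \<phi>' where \<phi>': "(\<phi> has_derivative \<phi>') (at x)"
    using assms unfolding differentiable_def by blast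
  interpret bounded_linear \<phi>' using \<phi>' by (rule has_derivative_bounded_linear)
  define v where "v = (\<Sum>b\<in>Basis. \<phi>' b *\<^sub>R b)"
  have "\<phi>' h = h \<bullet> v" for h
  proof -
    have "\<phi>' h = \<phi>' (\<Sum>b\<in>Basis. (h \<bullet> b) *\<^sub>R b)"
      by (simp add: euclidean_representation)
    then show ?thesis
      by (simp add: sum scaleR v_def inner_sum_right mult.commute)
  qed
  then have v: "GDERIV \<phi> x :> v"
    using \<phi>' by (simp add: gderiv_def ext[of \<phi>' "\<lambda>h. h \<bullet> v"])
  have "w = v" if "GDERIV \<phi> x :> w" for w
  proof -
    have "(\<lambda>h. h \<bullet> w) = (\<lambda>h. h \<bullet> v)"
      using has_derivative_unique that v unfolding gderiv_def by blast
    then show ?thesis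
      by (metis inner_commute vector_eq_ldot)
  qed
  with v show ?thesis
    unfolding gradient_def by (rule theI[where P = "\<lambda>w. GDERIV \<phi> x :> w"])
qed

text \<open>One-dimensional mean value theorem along the segment from \<open>x\<close> to
  \<open>y\<close>. Of the position of the intermediate point only its distance from
  \<open>x\<close> is kept, which is what the Lipschitz bound on the gradient consumes.\<close>

lemma gradient_mean_value:
  fixes \<phi> :: "'a::euclidean_space \<Rightarrow> real"
  assumes "\<And>z. \<phi> differentiable (at z)"
  obtains z where "norm (z - x) \<le> norm (y - x)" "\<phi> y - \<phi> x = (y - x) \<bullet> gradient \<phi> z"
proof -
  have "\<exists>t\<in>{0..1}. \<phi> (x + 1 *\<^sub>R (y - x)) - \<phi> (x + 0 *\<^sub>R (y - x))
      = ((1 - 0) *\<^sub>R (y - x)) \<bullet> gradient \<phi> (x + t *\<^sub>R (y - x))"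
  proof (rule mvt_very_simple)
    fix t :: real
    have 1: "((\<lambda>t. x + t *\<^sub>R (y - x)) has_derivative (\<lambda>s. s *\<^sub>R (y - x))) (at t within {0..1})"
      by (auto intro!: derivative_eq_intros)
    have 2: "(\<phi> has_derivative (\<lambda>h. h \<bullet> gradient \<phi> (x + t *\<^sub>R (y - x))))
        (at (x + t *\<^sub>R (y - x)) within (\<lambda>t. x + t *\<^sub>R (y - x)) ` {0..1})"
      using GDERIV_gradient[OF assms] unfolding gderiv_def
      by (rule has_derivative_at_withinI)
    show "((\<lambda>t. \<phi> (x + t *\<^sub>R (y - x))) has_derivative
        (\<lambda>s. (s *\<^sub>R (y - x)) \<bullet> gradient \<phi> (x + t *\<^sub>R (y - x)))) (at t within {0..1})"
      using diff_chain_within[OF 1 2] by (simp add: o_def)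
  qed simp
  then obtain t where t: "t \<in> {0..1}"
    "\<phi> y - \<phi> x = (y - x) \<bullet> gradient \<phi> (x + t *\<^sub>R (y - x))"
    by auto
  show ?thesis
  proof
    show "norm (x + t *\<^sub>R (y - x) - x) \<le> norm (y - x)"
      using t(1) by (auto simp: mult_left_le_one_le)
  qed (use t in simp)
qed

text \<open>The mean value theorem gives only \<open>L\<close> where the optimal constant is \<open>L/2\<close>; constants do not matter here.\<close>

lemma descent_inequality:
  fixes \<phi> :: "'a::euclidean_space \<Rightarrow> real"
  assumes "\<And>z. \<phi> differentiable (at z)" and L: "L-lipschitz_on UNIV (gradient \<phi>)"
  shows "\<phi> y \<le> \<phi> x + (y - x) \<bullet> gradient \<phi> x + L * (norm (y - x))\<^sup>2"
proof -
  obtain z where z: "norm (z - x) \<le> norm (y - x)" "\<phi> y - \<phi> x = (y - x) \<bullet> gradient \<phi> z"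
    using gradient_mean_value[OF assms(1)] by metis
  have "(y - x) \<bullet> (gradient \<phi> z - gradient \<phi> x)
      \<le> norm (y - x) * norm (gradient \<phi> z - gradient \<phi> x)"
    by (rule norm_cauchy_schwarz)
  also have "\<dots> \<le> norm (y - x) * (L * norm (z - x))"
    using lipschitz_onD[OF L, of z x] by (intro mult_left_mono) (auto simp: dist_norm)
  also have "\<dots> \<le> norm (y - x) * (L * norm (y - x))"
    using z(1) lipschitz_on_nonneg[OF L] by (intro mult_left_mono) auto
  finally show ?thesis
    using z(2) by (simp add: inner_diff_right power2_eq_square algebra_simps)
qed

text \<open>Serves integrability: a bounded gradient forces at most linear growth, so composing with
  an integrable iterate stays integrable.\<close>

lemma lipschitz_on_gradient_bounded:
  fixes \<phi> :: "'a::euclidean_space \<Rightarrow> real"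
  assumes "\<And>z. \<phi> differentiable (at z)" and B: "\<And>z. norm (gradient \<phi> z) \<le> B"
  shows "B-lipschitz_on UNIV \<phi>"
proof (rule lipschitz_onI)
  show "0 \<le> B" using B[of 0] norm_ge_zero order_trans by blast
  fix y x :: 'a
  obtain z where z: "\<phi> y - \<phi> x = (y - x) \<bullet> gradient \<phi> z"
    using gradient_mean_value[OF assms(1)] by metis
  have "\<bar>(y - x) \<bullet> gradient \<phi> z\<bar> \<le> norm (y - x) * norm (gradient \<phi> z)"
    by (rule Cauchy_Schwarz_ineq2)
  also have "\<dots> \<le> norm (y - x) * B"
    using B by (intro mult_left_mono) auto
  finally show "dist (\<phi> y) (\<phi> x) \<le> B * dist y x"
    by (simp add: dist_norm z mult.commute)
qed

section \<open>Moments, independence and the expected decrease of one step\<close>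

text \<open>Nonnegativity of the variance bounds the first moment by the root of the second. Applied
  to an unbiased estimate, this also bounds the gradient that it estimates.\<close>

lemma (in prob_space) norm_expectation_le_second_moment:
  fixes v :: "'a \<Rightarrow> 'b::{banach, second_countable_topology}"
  assumes "integrable M v" "integrable M (\<lambda>s. (norm (v s))\<^sup>2)"
    and "expectation (\<lambda>s. (norm (v s))\<^sup>2) \<le> B\<^sup>2" "0 \<le> B"
  shows "expectation (\<lambda>s. norm (v s)) \<le> B" "norm (expectation v) \<le> B"
proof -
  have "(expectation (\<lambda>s. norm (v s)))\<^sup>2 \<le> expectation (\<lambda>s. (norm (v s))\<^sup>2)"
    using variance_eq[of "\<lambda>s. norm (v s)"] variance_positive[of "\<lambda>s. norm (v s)"] assms(1,2)
    by simp
  with assms(3,4) show *: "expectation (\<lambda>s. norm (v s)) \<le> B"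
    by (meson order_trans power2_le_imp_le)
  show "norm (expectation v) \<le> B"
    using integral_norm_bound[of M v] * by linarith
qed

text \<open>Fubini on the product law averages over \<open>S\<close> with \<open>X\<close> frozen,
  which replaces conditional expectations. The bound \<open>B\<close>, uniform in \<open>z\<close>,
  supplies the integrability on the product.\<close>

lemma (in prob_space) independent_pair_expectation:
  fixes F :: "'b \<times> 'c \<Rightarrow> 'd::{banach, second_countable_topology}"
  assumes D: "prob_space D" and sets_D: "sets D = sets N'"
    and X[measurable]: "X \<in> measurable M N" and S[measurable]: "S \<in> measurable M N'"
    and joint: "distr M (N \<Otimes>\<^sub>M N') (\<lambda>\<omega>. (X \<omega>, S \<omega>)) = distr M N X \<Otimes>\<^sub>M D"
    and F[measurable]: "F \<in> borel_measurable (N \<Otimes>\<^sub>M N')"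
    and int: "\<And>z. z \<in> space N \<Longrightarrow> integrable D (\<lambda>s. F (z, s))"
    and B: "\<And>z. z \<in> space N \<Longrightarrow> (\<integral>s. norm (F (z, s)) \<partial>D) \<le> B"
  shows "integrable M (\<lambda>\<omega>. F (X \<omega>, S \<omega>))"
    and "expectation (\<lambda>\<omega>. F (X \<omega>, S \<omega>)) = expectation (\<lambda>\<omega>. \<integral>s. F (X \<omega>, s) \<partial>D)"
proof -
  interpret D: prob_space D by fact
  interpret P: prob_space "distr M N X" by (rule prob_space_distr) fact
  interpret PD: pair_sigma_finite "distr M N X" D ..
  have F': "F \<in> borel_measurable (distr M N X \<Otimes>\<^sub>M D)"
    using F by (simp add: measurable_cong_sets[OF sets_pair_measure_cong[OF sets_distr sets_D] refl])
  note [measurable] = F'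
  have FN[measurable]: "F \<in> borel_measurable (N \<Otimes>\<^sub>M D)"
    using F by (simp add: measurable_cong_sets[OF sets_pair_measure_cong[OF refl sets_D] refl])
  have PF: "integrable (distr M N X \<Otimes>\<^sub>M D) F"
  proof (rule PD.Fubini_integrable[OF F'])
    show "integrable (distr M N X) (\<lambda>z. \<integral>s. norm (F (z, s)) \<partial>D)"
      by (rule P.integrable_const_bound[where B = B]) (use B in \<open>auto intro!: AE_I2\<close>)
    show "AE z in distr M N X. integrable D (\<lambda>s. F (z, s))"
      using int by (intro AE_I2) auto
  qed
  then show "integrable M (\<lambda>\<omega>. F (X \<omega>, S \<omega>))"
    by (subst (asm) joint[symmetric], subst (asm) integrable_distr_eq) auto
  have "expectation (\<lambda>\<omega>. F (X \<omega>, S \<omega>)) = integral\<^sup>L (distr M N X \<Otimes>\<^sub>M D) F"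
    by (subst joint[symmetric], subst integral_distr) auto
  also have "\<dots> = (\<integral>z. \<integral>s. F (z, s) \<partial>D \<partial>distr M N X)"
    by (rule PD.integral_fst'[OF PF, symmetric])
  also have "\<dots> = expectation (\<lambda>\<omega>. \<integral>s. F (X \<omega>, s) \<partial>D)"
    by (rule integral_distr) auto
  finally show "expectation (\<lambda>\<omega>. F (X \<omega>, S \<omega>)) = expectation (\<lambda>\<omega>. \<integral>s. F (X \<omega>, s) \<partial>D)" .
qed

lemma (in prob_space) integrable_lipschitz_compose:
  fixes \<phi> :: "'b::euclidean_space \<Rightarrow> real"
  assumes \<phi>: "B-lipschitz_on UNIV \<phi>" and X: "integrable M X"
  shows "integrable M (\<lambda>\<omega>. \<phi> (X \<omega>))"
proof (rule Bochner_Integration.integrable_bound)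
  show "integrable M (\<lambda>\<omega>. \<bar>\<phi> 0\<bar> + B * norm (X \<omega>))"
    using X by simp
  have "\<phi> \<in> borel_measurable borel"
    using \<phi> by (simp add: borel_measurable_continuous_onI lipschitz_on_continuous_on)
  then show "(\<lambda>\<omega>. \<phi> (X \<omega>)) \<in> borel_measurable M"
    using borel_measurable_integrable[OF X] by (rule measurable_compose_rev)
  show "AE \<omega> in M. norm (\<phi> (X \<omega>)) \<le> norm (\<bar>\<phi> 0\<bar> + B * norm (X \<omega>))"
    using lipschitz_onD[OF \<phi>, of _ 0] by (auto simp: dist_norm intro!: AE_I2)
      (smt (verit, best))
qed

text \<open>The descent inequality is averaged over one step. Unbiasedness turns the expected inner
  product into the expected squared gradient norm, and the second moment controls the quadratic
  term. The first three conclusions provide integrability of the next iterate, of the squared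
  gradients and of function values.\<close>

lemma (in prob_space) expected_descent:
  fixes X :: "'a \<Rightarrow> 'b::euclidean_space" and S :: "'a \<Rightarrow> 'c::topological_space"
    and H :: "'b \<Rightarrow> 'c \<Rightarrow> 'b"
  assumes D: "prob_space D" and sets_D: "sets D = sets borel"
    and X: "integrable M X" and S[measurable]: "S \<in> borel_measurable M"
    and joint: "distr M (borel \<Otimes>\<^sub>M borel) (\<lambda>\<omega>. (X \<omega>, S \<omega>)) = distr M borel X \<Otimes>\<^sub>M D"
    and H[measurable]: "case_prod H \<in> borel_measurable (borel \<Otimes>\<^sub>M borel)"
    and H1: "\<And>z. integrable D (H z)" "\<And>z. (\<integral>s. H z s \<partial>D) = gradient \<phi> z"
    and H2: "\<And>z. integrable D (\<lambda>s. (norm (H z s))\<^sup>2)" "\<And>z. (\<integral>s. (norm (H z s))\<^sup>2 \<partial>D) \<le> B\<^sup>2"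
    and B: "0 \<le> B"
    and \<phi>: "\<And>z. \<phi> differentiable (at z)" and L: "L-lipschitz_on UNIV (gradient \<phi>)"
  shows "integrable M (\<lambda>\<omega>. X \<omega> - a *\<^sub>R H (X \<omega>) (S \<omega>))" (is ?X')
    and "integrable M (\<lambda>\<omega>. (norm (gradient \<phi> (X \<omega>)))\<^sup>2)" (is ?G)
    and "B-lipschitz_on UNIV \<phi>" (is ?L)
    and "expectation (\<lambda>\<omega>. \<phi> (X \<omega> - a *\<^sub>R H (X \<omega>) (S \<omega>))) \<le> expectation (\<lambda>\<omega>. \<phi> (X \<omega>))
      - a * expectation (\<lambda>\<omega>. (norm (gradient \<phi> (X \<omega>)))\<^sup>2) + L * a\<^sup>2 * B\<^sup>2"
proof -
  interpret D: prob_space D by fact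
  have Xm[measurable]: "X \<in> borel_measurable M"
    using X by (rule borel_measurable_integrable)
  have grad[measurable]: "gradient \<phi> \<in> borel_measurable borel"
    using L by (simp add: borel_measurable_continuous_onI lipschitz_on_continuous_on)
  \<comment> \<open>The gradient is the mean of the estimate, so the moment bound limits it
    uniformly in \<open>z\<close>.\<close>
  have norm_H: "(\<integral>s. norm (H z s) \<partial>D) \<le> B" and norm_grad: "norm (gradient \<phi> z) \<le> B" for z
    using D.norm_expectation_le_second_moment[OF H1(1) H2(1) H2(2) B] H1(2) by auto
  note pair = independent_pair_expectation[OF D sets_D Xm S joint]
  have int_H: "integrable M (\<lambda>\<omega>. H (X \<omega>) (S \<omega>))"
    using pair(1)[of "case_prod H" B] H1(1) norm_H by auto
  have int_sq: "integrable M (\<lambda>\<omega>. (norm (H (X \<omega>) (S \<omega>)))\<^sup>2)"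
    and eq_sq: "expectation (\<lambda>\<omega>. (norm (H (X \<omega>) (S \<omega>)))\<^sup>2)
      = expectation (\<lambda>\<omega>. \<integral>s. (norm (H (X \<omega>) s))\<^sup>2 \<partial>D)"
    using pair[of "\<lambda>(z, s). (norm (H z s))\<^sup>2" "B\<^sup>2"] H2 by auto
  have HD: "case_prod H \<in> borel_measurable (borel \<Otimes>\<^sub>M D)"
    using H by (simp add: measurable_cong_sets[OF sets_pair_measure_cong[OF refl sets_D] refl])
  note [measurable] = HD
  have "expectation (\<lambda>\<omega>. \<integral>s. (norm (H (X \<omega>) s))\<^sup>2 \<partial>D) \<le> expectation (\<lambda>\<omega>. B\<^sup>2)"
  proof (rule integral_mono)
    show "integrable M (\<lambda>\<omega>. \<integral>s. (norm (H (X \<omega>) s))\<^sup>2 \<partial>D)"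
      by (rule integrable_const_bound[where B = "B\<^sup>2"]) (use H2 in \<open>auto intro!: AE_I2\<close>)
  qed (use H2 in auto)
  with eq_sq have le_sq: "expectation (\<lambda>\<omega>. (norm (H (X \<omega>) (S \<omega>)))\<^sup>2) \<le> B\<^sup>2"
    by (simp add: prob_space)
  have int_z: "integrable D (\<lambda>s. H z s \<bullet> gradient \<phi> z)" for z
    using H1(1) by auto
  \<comment> \<open>The uniform bound that Fubini needs for the inner product: one factor
    \<open>B\<close> comes from the first moment, the other from the gradient.\<close>
  have "(\<integral>s. norm (H z s \<bullet> gradient \<phi> z) \<partial>D) \<le> B * B" for z
  proof -
    have "(\<integral>s. norm (H z s \<bullet> gradient \<phi> z) \<partial>D) \<le> (\<integral>s. norm (H z s) * B \<partial>D)"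
    proof (rule integral_mono)
      fix s
      show "norm (H z s \<bullet> gradient \<phi> z) \<le> norm (H z s) * B"
        using Cauchy_Schwarz_ineq2[of "H z s" "gradient \<phi> z"]
          mult_left_mono[OF norm_grad, of "norm (H z s)" z] by simp
    qed (use int_z H1(1) in auto)
    also have "\<dots> \<le> B * B"
      using norm_H B by (simp add: mult_right_mono)
    finally show ?thesis .
  qed
  then have int_inner: "integrable M (\<lambda>\<omega>. H (X \<omega>) (S \<omega>) \<bullet> gradient \<phi> (X \<omega>))"
    and "expectation (\<lambda>\<omega>. H (X \<omega>) (S \<omega>) \<bullet> gradient \<phi> (X \<omega>))
      = expectation (\<lambda>\<omega>. \<integral>s. H (X \<omega>) s \<bullet> gradient \<phi> (X \<omega>) \<partial>D)"
    using pair[of "\<lambda>(z, s). H z s \<bullet> gradient \<phi> z" "B * B"] int_z by auto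
  \<comment> \<open>With the point frozen, the inner product commutes with the integral over
    \<open>s\<close>, and the mean of \<open>H z\<close> is
    \<open>gradient \<phi> z\<close>.\<close>
  then have eq_inner: "expectation (\<lambda>\<omega>. H (X \<omega>) (S \<omega>) \<bullet> gradient \<phi> (X \<omega>))
      = expectation (\<lambda>\<omega>. (norm (gradient \<phi> (X \<omega>)))\<^sup>2)"
    using H1 by (simp add: power2_norm_eq_inner)
  show ?X' using X int_H by simp
  show ?G
    by (rule integrable_const_bound[where B = "B\<^sup>2"])
      (use norm_grad in \<open>auto intro!: AE_I2 power_mono\<close>)
  show ?L using \<phi> norm_grad by (rule lipschitz_on_gradient_bounded)
  note int_\<phi> = integrable_lipschitz_compose[OF \<open>?L\<close>]
  have "expectation (\<lambda>\<omega>. \<phi> (X \<omega> - a *\<^sub>R H (X \<omega>) (S \<omega>)))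
      \<le> expectation (\<lambda>\<omega>. \<phi> (X \<omega>) - a * (H (X \<omega>) (S \<omega>) \<bullet> gradient \<phi> (X \<omega>))
        + L * a\<^sup>2 * (norm (H (X \<omega>) (S \<omega>)))\<^sup>2)"
  proof (rule integral_mono)
    show "integrable M (\<lambda>\<omega>. \<phi> (X \<omega> - a *\<^sub>R H (X \<omega>) (S \<omega>)))"
      using \<open>?X'\<close> by (rule int_\<phi>)
    show "integrable M (\<lambda>\<omega>. \<phi> (X \<omega>) - a * (H (X \<omega>) (S \<omega>) \<bullet> gradient \<phi> (X \<omega>))
        + L * a\<^sup>2 * (norm (H (X \<omega>) (S \<omega>)))\<^sup>2)"
      using int_\<phi>[OF X] int_inner int_sq by simp
    fix \<omega>
    show "\<phi> (X \<omega> - a *\<^sub>R H (X \<omega>) (S \<omega>)) \<le> \<phi> (X \<omega>)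
        - a * (H (X \<omega>) (S \<omega>) \<bullet> gradient \<phi> (X \<omega>)) + L * a\<^sup>2 * (norm (H (X \<omega>) (S \<omega>)))\<^sup>2"
      using descent_inequality[OF \<phi> L, of "X \<omega> - a *\<^sub>R H (X \<omega>) (S \<omega>)" "X \<omega>"]
      by (simp add: power_mult_distrib mult.assoc)
  qed
  also have "\<dots> = expectation (\<lambda>\<omega>. \<phi> (X \<omega>)) - a * expectation (\<lambda>\<omega>. (norm (gradient \<phi> (X \<omega>)))\<^sup>2)
      + L * a\<^sup>2 * expectation (\<lambda>\<omega>. (norm (H (X \<omega>) (S \<omega>)))\<^sup>2)"
    using int_\<phi>[OF X] int_inner int_sq by (simp add: eq_inner)
  also have "L * a\<^sup>2 * expectation (\<lambda>\<omega>. (norm (H (X \<omega>) (S \<omega>)))\<^sup>2) \<le> L * a\<^sup>2 * B\<^sup>2"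
    using le_sq lipschitz_on_nonneg[OF L] by (intro mult_left_mono) auto
  finally show "expectation (\<lambda>\<omega>. \<phi> (X \<omega> - a *\<^sub>R H (X \<omega>) (S \<omega>))) \<le> expectation (\<lambda>\<omega>. \<phi> (X \<omega>))
      - a * expectation (\<lambda>\<omega>. (norm (gradient \<phi> (X \<omega>)))\<^sup>2) + L * a\<^sup>2 * B\<^sup>2"
    by simp
qed

section \<open>The iterates as functions of the past realizations\<close>

text \<open>The method numbers its points from 1, so \<open>x (Suc k)\<close> is the iterate number \<open>k\<close>.\<close>

primrec ssg_iterate ::
  "('a::real_normed_vector \<Rightarrow> 's \<Rightarrow> real \<Rightarrow> 'a) \<Rightarrow> (nat \<Rightarrow> real) \<Rightarrow> (nat \<Rightarrow> real) \<Rightarrow> 'a \<Rightarrow>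
   nat \<Rightarrow> (nat \<Rightarrow> 's) \<Rightarrow> 'a" where
  "ssg_iterate Gr \<alpha> \<mu> x1 0 u = x1"
| "ssg_iterate Gr \<alpha> \<mu> x1 (Suc k) u = ssg_iterate Gr \<alpha> \<mu> x1 k u
     - \<alpha> (Suc k) *\<^sub>R Gr (ssg_iterate Gr \<alpha> \<mu> x1 k u) (u (Suc k)) (\<mu> (Suc k))"

lemma ssg_iterate_cong:
  "(\<And>i. i \<in> {1..k} \<Longrightarrow> u i = v i) \<Longrightarrow> ssg_iterate Gr \<alpha> \<mu> x1 k u = ssg_iterate Gr \<alpha> \<mu> x1 k v"
  by (induction k) auto

lemma measurable_ssg_iterate:
  fixes Gr :: "'a::{second_countable_topology, real_normed_vector} \<Rightarrow> 's::topological_space \<Rightarrow> real \<Rightarrow> 'a"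
  assumes "\<And>\<nu>. 0 < \<nu> \<Longrightarrow> (\<lambda>(z, s). Gr z s \<nu>) \<in> borel_measurable (borel \<Otimes>\<^sub>M borel)"
    and "\<And>k. 1 \<le> k \<Longrightarrow> 0 < \<mu> k" and "{1..k} \<subseteq> J"
  shows "ssg_iterate Gr \<alpha> \<mu> x1 k \<in> borel_measurable (Pi\<^sub>M J (\<lambda>_. borel))"
  using assms(3)
proof (induction k)
  case 0
  have "ssg_iterate Gr \<alpha> \<mu> x1 0 = (\<lambda>_. x1)" by auto
  then show ?case by simp
next
  case (Suc k)
  then have "{1..k} \<subseteq> J" and "Suc k \<in> J" by auto
  then have [measurable]: "ssg_iterate Gr \<alpha> \<mu> x1 k \<in> borel_measurable (Pi\<^sub>M J (\<lambda>_. borel))"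
    "(\<lambda>u::nat \<Rightarrow> 's. u (Suc k)) \<in> borel_measurable (Pi\<^sub>M J (\<lambda>_. borel))"
    using Suc.IH by (blast, simp)
  have "0 < \<mu> (Suc k)" using assms(2) by simp
  note [measurable] = assms(1)[OF this]
  have "ssg_iterate Gr \<alpha> \<mu> x1 (Suc k) = (\<lambda>u. ssg_iterate Gr \<alpha> \<mu> x1 k u
      - \<alpha> (Suc k) *\<^sub>R Gr (ssg_iterate Gr \<alpha> \<mu> x1 k u) (u (Suc k)) (\<mu> (Suc k)))"
    by auto
  then show ?case by simp
qed

text \<open>The point \<open>x k\<close> is a measurable function of the realizations with indices
  below \<open>k\<close>. Splitting the independent family into the blocks \<open>{1..<k}\<close>
  and \<open>{k}\<close> gives a product law for the blocks, whose image is the joint law of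
  \<open>x k\<close> and \<open>\<xi> k\<close>.\<close>

lemma ssg_method_independent:
  fixes Gr :: "'a::{second_countable_topology, real_normed_vector} \<Rightarrow> 's::topological_space \<Rightarrow> real \<Rightarrow> 'a"
  assumes "prob_space M" and ssg: "ssg_method M D Gr \<alpha> \<mu> x1 \<xi> x"
    and Gr: "\<And>\<nu>. 0 < \<nu> \<Longrightarrow> (\<lambda>(z, s). Gr z s \<nu>) \<in> borel_measurable (borel \<Otimes>\<^sub>M borel)"
    and "1 \<le> k"
  shows "x k \<in> borel_measurable M" and "\<xi> k \<in> borel_measurable M"
    and "distr M (borel \<Otimes>\<^sub>M borel) (\<lambda>\<omega>. (x k \<omega>, \<xi> k \<omega>)) = distr M borel (x k) \<Otimes>\<^sub>M D"
proof -
  interpret prob_space M by fact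
  have \<mu>: "0 < \<mu> k" if "1 \<le> k" for k
    using ssg that by (simp add: ssg_method_def)
  \<comment> \<open>Index shift: \<open>x k\<close> is \<open>ssg_iterate\<close> at
    \<open>j = k - 1\<close>, which reads only the realizations 1 to \<open>j\<close>.\<close>
  obtain j where k: "k = Suc j" using \<open>1 \<le> k\<close> by (cases k) auto
  let ?past = "\<lambda>\<omega>. restrict (\<lambda>i. \<xi> i \<omega>) {1..<k}" and ?now = "\<lambda>\<omega>. restrict (\<lambda>i. \<xi> i \<omega>) {k}"
  have iter: "x (Suc i) \<omega> = ssg_iterate Gr \<alpha> \<mu> x1 i (\<lambda>i. \<xi> i \<omega>)" if "\<omega> \<in> space M" for i \<omega>
    using that ssg by (induction i) (auto simp: ssg_method_def)
  have x_eq: "x k \<omega> = (ssg_iterate Gr \<alpha> \<mu> x1 j \<circ> ?past) \<omega>" if "\<omega> \<in> space M" for \<omega>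
    using iter[OF that] by (auto simp: k intro!: ssg_iterate_cong)
  have "indep_var (Pi\<^sub>M {1..<k} (\<lambda>_. borel)) ?past (Pi\<^sub>M {k} (\<lambda>_. borel)) ?now"
    by (rule indep_var_restrict[of _ _ "{1..}"]) (use ssg \<open>1 \<le> k\<close> in \<open>auto simp: ssg_method_def\<close>)
  then have past: "random_variable (Pi\<^sub>M {1..<k} (\<lambda>_. borel)) ?past"
    and now: "random_variable (Pi\<^sub>M {k} (\<lambda>_. borel)) ?now"
    and joint: "distr M (Pi\<^sub>M {1..<k} (\<lambda>_. borel)) ?past \<Otimes>\<^sub>M distr M (Pi\<^sub>M {k} (\<lambda>_. borel)) ?now
      = distr M (Pi\<^sub>M {1..<k} (\<lambda>_. borel) \<Otimes>\<^sub>M Pi\<^sub>M {k} (\<lambda>_. borel)) (\<lambda>\<omega>. (?past \<omega>, ?now \<omega>))"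
    by (simp_all only: indep_var_distribution_eq)
  note [measurable] = past now
  have iter_m[measurable]: "ssg_iterate Gr \<alpha> \<mu> x1 j \<in> borel_measurable (Pi\<^sub>M {1..<k} (\<lambda>_. borel))"
    by (rule measurable_ssg_iterate) (use Gr \<mu> k in auto)
  have eval_m[measurable]: "(\<lambda>u::nat \<Rightarrow> 's. u k) \<in> borel_measurable (Pi\<^sub>M {k} (\<lambda>_. borel))"
    by simp
  show \<xi>_m: "\<xi> k \<in> borel_measurable M"
    using measurable_comp[OF now eval_m] by (simp add: o_def)
  show "x k \<in> borel_measurable M"
    using measurable_comp[OF past iter_m] by (subst measurable_cong[OF x_eq])
  have law_x: "distr (distr M (Pi\<^sub>M {1..<k} (\<lambda>_. borel)) ?past) borel (ssg_iterate Gr \<alpha> \<mu> x1 j)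
      = distr M borel (x k)"
    unfolding distr_distr[OF iter_m past] by (intro distr_cong refl) (simp only: x_eq)
  have law_\<xi>: "distr (distr M (Pi\<^sub>M {k} (\<lambda>_. borel)) ?now) borel (\<lambda>u. u k) = D"
    using ssg \<open>1 \<le> k\<close> unfolding distr_distr[OF eval_m now]
    by (simp add: o_def ssg_method_def)
  \<comment> \<open>As the law of \<open>\<xi> k\<close>, \<open>D\<close> is a probability measure;
    its sigma-finiteness is needed to push the product forward factor by factor.\<close>
  interpret D: prob_space D
    using prob_space_distr[OF \<xi>_m] ssg \<open>1 \<le> k\<close> by (simp add: ssg_method_def)
  have "distr M borel (x k) \<Otimes>\<^sub>M D
      = distr (distr M (Pi\<^sub>M {1..<k} (\<lambda>_. borel)) ?past) borel (ssg_iterate Gr \<alpha> \<mu> x1 j)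
        \<Otimes>\<^sub>M distr (distr M (Pi\<^sub>M {k} (\<lambda>_. borel)) ?now) borel (\<lambda>u. u k)"
    by (simp only: law_x law_\<xi>)
  also have "\<dots> = distr (distr M (Pi\<^sub>M {1..<k} (\<lambda>_. borel)) ?past \<Otimes>\<^sub>M distr M (Pi\<^sub>M {k} (\<lambda>_. borel)) ?now)
      (borel \<Otimes>\<^sub>M borel) (\<lambda>(u, v). (ssg_iterate Gr \<alpha> \<mu> x1 j u, v k))"
    by (rule pair_measure_distr) (simp_all only: measurable_distr_eq1 iter_m eval_m law_\<xi> D.sigma_finite_measure_axioms)
  \<comment> \<open>Independence enters here: \<open>joint\<close> replaces the product of the block
    laws by the law of the pair of blocks.\<close>
  also have "\<dots> = distr M (borel \<Otimes>\<^sub>M borel) (\<lambda>\<omega>. (x k \<omega>, \<xi> k \<omega>))"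
    unfolding joint
    by (subst distr_distr[OF _ measurable_Pair[OF past now]], measurable)
      (intro distr_cong refl, simp add: x_eq)
  finally show "distr M (borel \<Otimes>\<^sub>M borel) (\<lambda>\<omega>. (x k \<omega>, \<xi> k \<omega>)) = distr M borel (x k) \<Otimes>\<^sub>M D" ..
qed

text \<open>Telescoping bounds the partial sums of \<open>p\<close> by \<open>e 0 - m\<close> plus
  the total of \<open>q\<close>, and nonnegative terms with bounded partial sums are
  summable.\<close>

lemma summable_of_descent:
  fixes e p q :: "nat \<Rightarrow> real"
  assumes "\<And>k. 0 \<le> p k" "\<And>k. 0 \<le> q k" "summable q"
    and step: "\<And>k. e (Suc k) \<le> e k - p k + q k" and m: "\<And>k. m \<le> e k"
  shows "summable p"
proof (rule bounded_imp_summable)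
  fix n
  have "(\<Sum>k<n. p k) \<le> e 0 - e n + (\<Sum>k<n. q k)" for n
  proof (induction n)
    case (Suc n)
    then show ?case using step[of n] by simp
  qed simp
  from this[of "Suc n"] show "sum p {..n} \<le> e 0 - m + suminf q"
    using m[of "Suc n"] sum_le_suminf[OF assms(3), of "{..<Suc n}"] assms(2)
    by (simp add: lessThan_Suc_atMost)
qed fact

theorem corollary3p2:
  fixes f :: "real ^ 'n \<Rightarrow> real"
    and ft :: "real ^ 'n \<Rightarrow> real \<Rightarrow> real"
    and Gr :: "real ^ 'n \<Rightarrow> real ^ 'm \<Rightarrow> real \<Rightarrow> real ^ 'n"
    and D :: "(real ^ 'm) measure"
    and M :: "'w measure"
    and \<xi> :: "nat \<Rightarrow> 'w \<Rightarrow> real ^ 'm"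
    and x :: "nat \<Rightarrow> 'w \<Rightarrow> real ^ 'n"
    and x1 :: "real ^ 'n"
    and y g :: "nat \<Rightarrow> 'w \<Rightarrow> real ^ 'n"
    and \<alpha> \<mu> A :: "nat \<Rightarrow> real"
    and G C C0 C1 E1 E2 d :: real
  assumes lipschitz: "locally_lipschitz f"
    and bounded_below: "bdd_below (range f)"
    and smoothing: "smoothing_function f ft"
    and prob_D: "prob_space D" "sets D = sets borel"
    and measurable_Gr: "\<And>\<nu>. \<nu> > 0 \<Longrightarrow>
          (\<lambda>(z, s). Gr z s \<nu>) \<in> borel_measurable (borel \<Otimes>\<^sub>M borel)"
    and unbiased: "\<And>z \<nu>. \<nu> > 0 \<Longrightarrow>
          integrable D (\<lambda>s. Gr z s \<nu>) \<and>
          (\<integral>s. Gr z s \<nu> \<partial>D) = gradient (\<lambda>u. ft u \<nu>) z"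
    and second_moment: "G > 0" "\<And>z \<nu>. \<nu> > 0 \<Longrightarrow>
          integrable D (\<lambda>s. (norm (Gr z s \<nu>))\<^sup>2) \<and>
          (\<integral>s. (norm (Gr z s \<nu>))\<^sup>2 \<partial>D) \<le> G\<^sup>2 / \<nu>\<^sup>2"
    and approximation: "C > 0" "\<And>z \<nu>. \<nu> > 0 \<Longrightarrow> \<bar>f z - ft z \<nu>\<bar> \<le> C * \<nu>"
    and gradient_lipschitz: "C0 > 0" "\<And>\<nu>. \<nu> > 0 \<Longrightarrow>
          (C0 / \<nu>)-lipschitz_on UNIV (gradient (\<lambda>u. ft u \<nu>))"
    and parameter_lipschitz: "C1 > 0" "\<And>z \<nu> \<nu>'. \<nu> > 0 \<Longrightarrow> \<nu>' > 0 \<Longrightarrow>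
          \<bar>ft z \<nu>' - ft z \<nu>\<bar> \<le> C1 * \<bar>\<nu>' - \<nu>\<bar>"
    and subgradient_consistency: "E1 > 0" "E2 > 0" "\<And>z \<nu>. \<nu> > 0 \<Longrightarrow>
          \<exists>u\<in>cball z (E1 * \<nu>). \<exists>h\<in>clarke_subdifferential f u.
            norm (gradient (\<lambda>u. ft u \<nu>) z - h) \<le> E2 * \<nu>"
    and d: "1 < d" "d \<le> 7 / 5"
    and prob_M: "prob_space M"
    and ssg: "ssg_method M D Gr \<alpha> \<mu> x1 \<xi> x"
    and \<alpha>_diverges: "filterlim (\<lambda>T. \<Sum>k=1..T. \<alpha> k) at_top at_top"
    and \<alpha>_summable: "summable (\<lambda>k. \<alpha> (Suc k) powr d)"
    and \<mu>: "\<And>k. k \<ge> 1 \<Longrightarrow> \<mu> k = \<alpha> k powr (- d / 3 + 2 / 3)"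
    and y: "\<And>k \<omega>. k \<ge> 1 \<Longrightarrow> \<omega> \<in> space M \<Longrightarrow> y k \<omega> \<in> cball (x k \<omega>) (E1 * \<mu> k)"
    and g: "\<And>k. k \<ge> 1 \<Longrightarrow> g k \<in> borel_measurable M"
      "\<And>k \<omega>. k \<ge> 1 \<Longrightarrow> \<omega> \<in> space M \<Longrightarrow> g k \<omega> \<in> clarke_subdifferential f (y k \<omega>)"
      "\<And>k \<omega>. k \<ge> 1 \<Longrightarrow> \<omega> \<in> space M \<Longrightarrow>
          norm (gradient (\<lambda>u. ft u (\<mu> k)) (x k \<omega>) - g k \<omega>) \<le> E2 * \<mu> k"
    and A: "\<And>T. A T = (\<Sum>k=1..T. \<alpha> k)"
  shows "(\<forall>T. integrable M (\<lambda>\<omega>. \<Sum>k=1..T. \<alpha> k * (norm (g k \<omega>))\<^sup>2)) \<and>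
         convergent (\<lambda>T. \<integral>\<omega>. (\<Sum>k=1..T. \<alpha> k * (norm (g k \<omega>))\<^sup>2) \<partial>M) \<and>
         (\<lambda>T. \<integral>\<omega>. (1 / A T) * (\<Sum>k=1..T. \<alpha> k * (norm (g k \<omega>))\<^sup>2) \<partial>M) \<longlonglongrightarrow> 0"
proof -
  interpret prob_space M by (rule prob_M)
  have \<alpha>_pos: "0 < \<alpha> k" and \<mu>_pos: "0 < \<mu> k" and \<mu>_dec: "\<mu> (Suc k) \<le> \<mu> k" if "k \<ge> 1" for k
    using ssg that by (auto simp: ssg_method_def)
  have x_1: "x 1 \<omega> = x1"
    and x_Suc: "k \<ge> 1 \<Longrightarrow> x (Suc k) \<omega> = x k \<omega> - \<alpha> k *\<^sub>R Gr (x k \<omega>) (\<xi> k \<omega>) (\<mu> k)"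
    if "\<omega> \<in> space M" for k \<omega>
    using ssg that by (auto simp: ssg_method_def)
  let ?grad = "\<lambda>k. gradient (\<lambda>u. ft u (\<mu> k))"
  have grad_lip: "(C0 / \<mu> k)-lipschitz_on UNIV (?grad k)" if "k \<ge> 1" for k
    using gradient_lipschitz(2) \<mu>_pos that by blast

  \<comment> \<open>Expected descent along the run\<close>
  have descent: "integrable M (x (Suc k))"
    "integrable M (\<lambda>\<omega>. (norm (?grad k (x k \<omega>)))\<^sup>2)"
    "(G / \<mu> k)-lipschitz_on UNIV (\<lambda>u. ft u (\<mu> k))"
    "expectation (\<lambda>\<omega>. ft (x (Suc k) \<omega>) (\<mu> k)) \<le> expectation (\<lambda>\<omega>. ft (x k \<omega>) (\<mu> k))
      - \<alpha> k * expectation (\<lambda>\<omega>. (norm (?grad k (x k \<omega>)))\<^sup>2) + C0 / \<mu> k * (\<alpha> k)\<^sup>2 * (G / \<mu> k)\<^sup>2"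
    if k: "k \<ge> 1" and int: "integrable M (x k)" for k
  proof -
    have indep: "\<xi> k \<in> borel_measurable M"
      "distr M (borel \<Otimes>\<^sub>M borel) (\<lambda>\<omega>. (x k \<omega>, \<xi> k \<omega>)) = distr M borel (x k) \<Otimes>\<^sub>M D"
      using ssg_method_independent(2,3)[OF prob_M ssg _ k] measurable_Gr by blast+
    have diff: "(\<lambda>u. ft u (\<mu> k)) differentiable (at z)" for z
      using smoothing \<mu>_pos[OF k] unfolding smoothing_function_def by blast
    \<comment> \<open>\<open>expected_descent\<close> is used with the bound
      \<open>B = G / \<mu> k\<close>.\<close>
    have B: "0 \<le> G / \<mu> k" "(\<integral>s. (norm (Gr z s (\<mu> k)))\<^sup>2 \<partial>D) \<le> (G / \<mu> k)\<^sup>2" for z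
      using second_moment(1) second_moment(2)[OF \<mu>_pos[OF k], of z] \<mu>_pos[OF k]
      by (auto simp: power_divide)
    note ed = expected_descent[OF prob_D int indep measurable_Gr[OF \<mu>_pos[OF k]]
        unbiased[OF \<mu>_pos[OF k], THEN conjunct1] unbiased[OF \<mu>_pos[OF k], THEN conjunct2]
        second_moment(2)[OF \<mu>_pos[OF k], THEN conjunct1] B(2,1) diff grad_lip[OF k]]
    show "integrable M (x (Suc k))"
      using ed(1)[of "\<alpha> k"] Bochner_Integration.integrable_cong[of M M "x (Suc k)", OF refl x_Suc[OF _ k]] by simp
    show "expectation (\<lambda>\<omega>. ft (x (Suc k) \<omega>) (\<mu> k)) \<le> expectation (\<lambda>\<omega>. ft (x k \<omega>) (\<mu> k))
      - \<alpha> k * expectation (\<lambda>\<omega>. (norm (?grad k (x k \<omega>)))\<^sup>2) + C0 / \<mu> k * (\<alpha> k)\<^sup>2 * (G / \<mu> k)\<^sup>2"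
      using ed(4)[of "\<alpha> k"]
        Bochner_Integration.integral_cong[of M M, OF refl arg_cong[OF x_Suc[OF _ k], of _ "\<lambda>u. ft u (\<mu> k)"]]
      by simp
    show "integrable M (\<lambda>\<omega>. (norm (?grad k (x k \<omega>)))\<^sup>2)"
      and "(G / \<mu> k)-lipschitz_on UNIV (\<lambda>u. ft u (\<mu> k))"
      using ed(2,3) .
  qed
  \<comment> \<open>\<open>descent\<close> presupposes integrability of the current iterate, so this
    is propagated by induction from the deterministic start.\<close>
  have int_x: "integrable M (x k)" if "k \<ge> 1" for k
    using that
  proof (induction k rule: nat_induct_at_least)
    case base
    show ?case using Bochner_Integration.integrable_cong[of M M "x 1", OF refl x_1] by simp
  next
    case (Suc k)
    then show ?case by (intro descent(1))
  qed

  \<comment> \<open>Summability of the weighted squared gradients\<close>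
  define a where "a k = expectation (\<lambda>\<omega>. (norm (?grad k (x k \<omega>)))\<^sup>2)" for k
  define e where "e k = expectation (\<lambda>\<omega>. ft (x k \<omega>) (\<mu> k)) + C1 * \<mu> k" for k
  \<comment> \<open>The indices are separate because the new point \<open>x (Suc k)\<close> is also
    evaluated at the old parameter \<open>\<mu> k\<close>.\<close>
  have int_ft: "integrable M (\<lambda>\<omega>. ft (x i \<omega>) (\<mu> j))" if "i \<ge> 1" "j \<ge> 1" for i j
    using descent(3)[OF that(2) int_x[OF that(2)]] int_x[OF that(1)] by (rule integrable_lipschitz_compose)
  obtain m where m: "m \<le> f z" for z
    using bounded_below by (auto simp: bdd_below_def)
  have summable_a: "summable (\<lambda>k. \<alpha> (Suc k) * a (Suc k))"
  proof (rule summable_of_descent)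
    show "0 \<le> \<alpha> (Suc k) * a (Suc k)" for k
      using \<alpha>_pos[of "Suc k"] by (simp add: a_def)
    show "summable (\<lambda>k. C0 * G\<^sup>2 * \<alpha> (Suc k) powr d)"
      using \<alpha>_summable by (rule summable_mult)
    show "0 \<le> C0 * G\<^sup>2 * \<alpha> (Suc k) powr d" for k
      using gradient_lipschitz(1) by simp
    \<comment> \<open>\<open>ft\<close> lies below \<open>f\<close> by at most
      \<open>C * \<mu> (Suc k)\<close>, hence by at most \<open>C * \<mu> 1\<close>, and the added
      term of \<open>e\<close> is nonnegative.\<close>
    show "m - C * \<mu> 1 \<le> e (Suc k)" for k
    proof -
      have \<mu>_le: "\<mu> (Suc k) \<le> \<mu> 1"
      proof (induction k)
        case (Suc k)
        then show ?case using \<mu>_dec[of "Suc k"] by simp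
      qed simp
      have "expectation (\<lambda>\<omega>. m - C * \<mu> 1) \<le> expectation (\<lambda>\<omega>. ft (x (Suc k) \<omega>) (\<mu> (Suc k)))"
      proof (rule integral_mono)
        fix \<omega>
        have "m \<le> ft (x (Suc k) \<omega>) (\<mu> (Suc k)) + C * \<mu> (Suc k)"
          using m[of "x (Suc k) \<omega>"] approximation(2)[OF \<mu>_pos[of "Suc k"], of "x (Suc k) \<omega>"] by simp
        moreover have "C * \<mu> (Suc k) \<le> C * \<mu> 1"
          using \<mu>_le approximation(1) by (intro mult_left_mono) auto
        ultimately show "m - C * \<mu> 1 \<le> ft (x (Suc k) \<omega>) (\<mu> (Suc k))" by linarith
      qed (use int_ft in auto)
      moreover have "0 \<le> C1 * \<mu> (Suc k)"
        using parameter_lipschitz(1) \<mu>_pos[of "Suc k"] by simp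
      ultimately show ?thesis by (simp add: e_def prob_space)
    qed
    show "e (Suc (Suc k)) \<le> e (Suc k) - \<alpha> (Suc k) * a (Suc k) + C0 * G\<^sup>2 * \<alpha> (Suc k) powr d" for k
    proof -
      let ?k = "Suc k"
      have k: "?k \<ge> 1" by simp
      have "expectation (\<lambda>\<omega>. ft (x (Suc ?k) \<omega>) (\<mu> (Suc ?k)))
          \<le> expectation (\<lambda>\<omega>. ft (x (Suc ?k) \<omega>) (\<mu> ?k) + C1 * (\<mu> ?k - \<mu> (Suc ?k)))"
      proof (rule integral_mono)
        fix \<omega>
        \<comment> \<open>Monotonicity of the parameters resolves the absolute value, so the cost of
          the change is exactly what the extra term of \<open>e\<close> loses.\<close>
        show "ft (x (Suc ?k) \<omega>) (\<mu> (Suc ?k)) \<le> ft (x (Suc ?k) \<omega>) (\<mu> ?k) + C1 * (\<mu> ?k - \<mu> (Suc ?k))"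
          using parameter_lipschitz(2)[of "\<mu> ?k" "\<mu> (Suc ?k)" "x (Suc ?k) \<omega>"]
            \<mu>_pos[of ?k] \<mu>_pos[of "Suc ?k"] \<mu>_dec[OF k] by simp
      qed (use int_ft in auto)
      also have "\<dots> = expectation (\<lambda>\<omega>. ft (x (Suc ?k) \<omega>) (\<mu> ?k)) + C1 * (\<mu> ?k - \<mu> (Suc ?k))"
        using int_ft by (simp add: prob_space)
      finally have "e (Suc ?k) \<le> e ?k - \<alpha> ?k * a ?k + C0 / \<mu> ?k * (\<alpha> ?k)\<^sup>2 * (G / \<mu> ?k)\<^sup>2"
        using descent(4)[OF k int_x[OF k]] by (simp add: e_def a_def right_diff_distrib)
      moreover have "C0 / \<mu> ?k * (\<alpha> ?k)\<^sup>2 * (G / \<mu> ?k)\<^sup>2 = C0 * G\<^sup>2 * \<alpha> ?k powr d"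
      proof -
        \<comment> \<open>Three times the exponent in \<open>\<mu>\<close> is \<open>2 - d\<close>,
          so dividing \<open>\<alpha>\<^sup>2\<close> by the cube of \<open>\<mu>\<close> leaves the
          exponent \<open>d\<close>.\<close>
        have "(\<mu> ?k) ^ 3 = \<alpha> ?k powr (2 - d)"
          using \<mu>[OF k] \<alpha>_pos[OF k] by (simp add: powr_power)
        then have "\<alpha> ?k powr (2 - (2 - d)) = (\<alpha> ?k)\<^sup>2 / (\<mu> ?k) ^ 3"
          using \<alpha>_pos[OF k] by (simp only: powr_diff powr_numeral)
        then have "\<alpha> ?k powr d = (\<alpha> ?k)\<^sup>2 / (\<mu> ?k) ^ 3"
          by simp
        then show ?thesis
          by (simp add: power_divide power2_eq_square power3_eq_cube mult_ac)
      qed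
      ultimately show ?thesis by simp
    qed
  qed

  \<comment> \<open>Summability of the subgradient approximation error\<close>
  define r where "r k = \<alpha> k * (\<mu> k)\<^sup>2" for k
  have summable_r: "summable (\<lambda>k. r (Suc k))"
  proof (rule summable_comparison_test_ev[OF _ \<alpha>_summable])
    \<comment> \<open>The comparison of exponents requires stepsizes at most 1. This holds
      eventually: the terms of the series tend to 0, while a stepsize of at least 1 would make its
      term at least 1.\<close>
    have "eventually (\<lambda>k. \<alpha> (Suc k) powr d < 1) sequentially"
      using summable_LIMSEQ_zero[OF \<alpha>_summable] by (rule order_tendstoD) simp
    then show "eventually (\<lambda>k. norm (r (Suc k)) \<le> \<alpha> (Suc k) powr d) sequentially"
    proof eventually_elim
      case (elim k)
      have pos: "0 < \<alpha> (Suc k)" by (simp add: \<alpha>_pos)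
      have "\<alpha> (Suc k) \<le> 1"
        using elim ge_one_powr_ge_zero[of "\<alpha> (Suc k)" d] d(1) by force
      moreover have "r (Suc k) = \<alpha> (Suc k) powr ((7 - 2 * d) / 3)"
      proof -
        have "(\<mu> (Suc k))\<^sup>2 = \<alpha> (Suc k) powr (2 * (- d / 3 + 2 / 3))"
          using pos \<mu>[of "Suc k"] by (simp add: powr_power)
        then have "r (Suc k) = \<alpha> (Suc k) powr (1 + 2 * (- d / 3 + 2 / 3))"
          using pos by (simp only: r_def powr_add powr_one)
        also have "1 + 2 * (- d / 3 + 2 / 3) = (7 - 2 * d) / 3"
          by (simp add: field_simps)
        finally show ?thesis .
      qed
      \<comment> \<open>For a base at most 1 the larger exponent gives the smaller power, and
        \<open>d \<le> (7 - 2 * d) / 3\<close>.\<close>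
      ultimately show ?case
        using pos d by (auto intro!: powr_mono')
    qed
  qed

  \<comment> \<open>Passage from gradients to subgradients\<close>
  have g_le: "(norm (g k \<omega>))\<^sup>2 \<le> 2 * (norm (?grad k (x k \<omega>)))\<^sup>2 + 2 * E2\<^sup>2 * (\<mu> k)\<^sup>2"
    if "k \<ge> 1" "\<omega> \<in> space M" for k \<omega>
  proof -
    let ?u = "norm (?grad k (x k \<omega>))"
    have "norm (g k \<omega>) \<le> ?u + E2 * \<mu> k"
      using g(3)[OF that] norm_triangle_sub[of "g k \<omega>" "?grad k (x k \<omega>)"]
      by (simp add: norm_minus_commute)
    then have "(norm (g k \<omega>))\<^sup>2 \<le> (?u + E2 * \<mu> k)\<^sup>2"
      by (intro power_mono) auto
    also have "\<dots> \<le> 2 * ?u\<^sup>2 + 2 * (E2 * \<mu> k)\<^sup>2"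
      using sum_squares_bound[of ?u "E2 * \<mu> k"] by (simp add: power2_sum)
    finally show ?thesis by (simp add: power_mult_distrib)
  qed
  have int_bound: "integrable M (\<lambda>\<omega>. 2 * (norm (?grad k (x k \<omega>)))\<^sup>2 + 2 * E2\<^sup>2 * (\<mu> k)\<^sup>2)" if "k \<ge> 1" for k
    using descent(2)[OF that int_x[OF that]] by simp
  \<comment> \<open>Measurability of \<open>g k\<close> is a hypothesis; integrability follows by
    domination through \<open>g_le\<close>.\<close>
  have int_g: "integrable M (\<lambda>\<omega>. (norm (g k \<omega>))\<^sup>2)" if "k \<ge> 1" for k
    using int_bound[OF that]
  proof (rule Bochner_Integration.integrable_bound)
    have [measurable]: "g k \<in> borel_measurable M" using g(1) that by simp
    show "(\<lambda>\<omega>. (norm (g k \<omega>))\<^sup>2) \<in> borel_measurable M" by measurable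
    show "AE \<omega> in M. norm ((norm (g k \<omega>))\<^sup>2) \<le> norm (2 * (norm (?grad k (x k \<omega>)))\<^sup>2 + 2 * E2\<^sup>2 * (\<mu> k)\<^sup>2)"
      using g_le[OF that] by (intro AE_I2) simp
  qed
  define b where "b k = expectation (\<lambda>\<omega>. (norm (g k \<omega>))\<^sup>2)" for k
  have b_le: "b k \<le> 2 * a k + 2 * E2\<^sup>2 * (\<mu> k)\<^sup>2" if "k \<ge> 1" for k
  proof -
    have "b k \<le> expectation (\<lambda>\<omega>. 2 * (norm (?grad k (x k \<omega>)))\<^sup>2 + 2 * E2\<^sup>2 * (\<mu> k)\<^sup>2)"
      unfolding b_def using int_g[OF that] int_bound[OF that] g_le[OF that] by (rule integral_mono)
    also have "\<dots> = 2 * a k + 2 * E2\<^sup>2 * (\<mu> k)\<^sup>2"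
      using descent(2)[OF that int_x[OF that]] by (simp add: a_def prob_space)
    finally show ?thesis .
  qed
  have summable_b: "summable (\<lambda>k. \<alpha> (Suc k) * b (Suc k))"
  proof (rule summable_comparison_test')
    show "summable (\<lambda>k. 2 * (\<alpha> (Suc k) * a (Suc k)) + 2 * E2\<^sup>2 * r (Suc k))"
      by (intro summable_add summable_mult summable_a summable_r)
    fix k
    have "\<alpha> (Suc k) * b (Suc k) \<le> \<alpha> (Suc k) * (2 * a (Suc k) + 2 * E2\<^sup>2 * (\<mu> (Suc k))\<^sup>2)"
      using \<alpha>_pos[of "Suc k"] b_le[of "Suc k"] by (intro mult_left_mono) auto
    moreover have "0 \<le> \<alpha> (Suc k) * b (Suc k)"
      using \<alpha>_pos[of "Suc k"] by (simp add: b_def)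
    ultimately show "norm (\<alpha> (Suc k) * b (Suc k)) \<le> 2 * (\<alpha> (Suc k) * a (Suc k)) + 2 * E2\<^sup>2 * r (Suc k)"
      by (simp add: r_def algebra_simps)
  qed

  \<comment> \<open>The two limits\<close>
  define S where "S T = (\<Sum>k<T. \<alpha> (Suc k) * b (Suc k))" for T
  have int_sum: "integrable M (\<lambda>\<omega>. \<Sum>k=1..T. \<alpha> k * (norm (g k \<omega>))\<^sup>2)" for T
    using int_g by (intro Bochner_Integration.integrable_sum integrable_mult_right) auto
  have exp_sum: "expectation (\<lambda>\<omega>. \<Sum>k=1..T. \<alpha> k * (norm (g k \<omega>))\<^sup>2) = S T" for T
  proof -
    have "expectation (\<lambda>\<omega>. \<Sum>k=1..T. \<alpha> k * (norm (g k \<omega>))\<^sup>2) = (\<Sum>k=1..T. \<alpha> k * b k)"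
      using int_g by (subst Bochner_Integration.integral_sum) (auto simp: b_def)
    then show ?thesis by (simp add: S_def sum.atLeast1_atMost_eq)
  qed
  have "convergent S"
    using summable_b unfolding summable_iff_convergent S_def .
  then obtain s where "S \<longlonglongrightarrow> s" by (auto simp: convergent_def)
  \<comment> \<open>The weighted sums converge, so it suffices that the normalizing factor vanishes.
    At \<open>T = 0\<close> it is the inverse of 0, which is 0 by convention and does not affect the
    limit.\<close>
  moreover have "(\<lambda>T. inverse (A T)) \<longlonglongrightarrow> 0"
    using tendsto_inverse_0_at_top[OF \<alpha>_diverges] by (simp add: A)
  ultimately have "(\<lambda>T. inverse (A T) * S T) \<longlonglongrightarrow> 0"
    using tendsto_mult by fastforce
  with \<open>convergent S\<close> int_sum show ?thesis
    by (simp add: exp_sum[unfolded One_nat_def] inverse_eq_divide)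
qed

end
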